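(* Let $K\ge1$ be an integer. If $3\mid K$, then $\pi_K(3)=2$; otherwise $\pi_K(3)=8$.
   Context: The $K$-Fibonacci sequence is $F_{K,0}=0$, $F_{K,1}=1$, $F_{K,n}=K F_{K,n-1}+F_{K,n-2}$; for an integer $m>1$, $\pi_K(m)$ is the length of its shortest period modulo $m$. *)

theory Defs
  imports "HOL-Number_Theory.Cong"
begin

fun kfib :: "int \<Rightarrow> nat \<Rightarrow> int" where
  "kfib K 0 = 0"
| "kfib K (Suc 0) = 1"
| "kfib K (Suc (Suc n)) = K * kfib K (Suc n) + kfib K n"

text \<open>The recurrence can be run backwards modulo \<open>m\<close>, so the sequence is purely periodic
  modulo any \<open>m > 1\<close>: a period is required to hold from index 0 on.\<close>

definition is_kfib_period :: "int \<Rightarrow> int \<Rightarrow> nat \<Rightarrow> bool" where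
  "is_kfib_period K m p \<longleftrightarrow> p > 0 \<and> (\<forall>n. [kfib K (n + p) = kfib K n] (mod m))"

definition kfib_pisano :: "int \<Rightarrow> int \<Rightarrow> nat" where
  "kfib_pisano K m = (LEAST p. is_kfib_period K m p)"

end

theory Submission
  imports Defs
begin

text \<open>If \<open>F\<^sub>p \<equiv> 0\<close>, the recurrence restarts at \<open>p\<close> with the factor \<open>F\<^sub>p\<^sub>+\<^sub>1\<close>, that is,
  \<open>F\<^sub>n\<^sub>+\<^sub>p \<equiv> F\<^sub>p\<^sub>+\<^sub>1 F\<^sub>n\<close>. Modulo a divisor of \<open>K\<close> this applies to \<open>p = 2\<close> with factor \<open>1\<close>. Modulo a
  divisor of \<open>K\<^sup>2 + 2\<close> it applies to \<open>p = 4\<close> with factor \<open>-1\<close>, so \<open>8\<close> is a period but \<open>4\<close> is not,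
  and the shortest period, being a divisor of \<open>8\<close>, is \<open>8\<close> itself. If \<open>3\<close> does not divide \<open>K\<close>, then
  it divides \<open>K\<^sup>2 + 2\<close>.\<close>

lemma kfib_add_cong:
  assumes "[kfib K p = 0] (mod m)"
  shows "[kfib K (n + p) = kfib K (Suc p) * kfib K n] (mod m)"
  using assms
proof (induction K n rule: kfib.induct)
  case (3 K n)
  then have "[K * kfib K (Suc n + p) + kfib K (n + p)
      = K * (kfib K (Suc p) * kfib K (Suc n)) + kfib K (Suc p) * kfib K n] (mod m)"
    by (intro cong_add cong_mult cong_refl)
  then show ?case by (simp add: algebra_simps)
qed simp_all

lemma is_kfib_period_iff:
  "is_kfib_period K m p \<longleftrightarrow> p > 0 \<and> [kfib K p = 0] (mod m) \<and> [kfib K (Suc p) = 1] (mod m)"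
proof
  assume "is_kfib_period K m p"
  then have "p > 0" "[kfib K (0 + p) = kfib K 0] (mod m)" "[kfib K (1 + p) = kfib K 1] (mod m)"
    unfolding is_kfib_period_def by blast+
  then show "p > 0 \<and> [kfib K p = 0] (mod m) \<and> [kfib K (Suc p) = 1] (mod m)" by simp
next
  assume restart: "p > 0 \<and> [kfib K p = 0] (mod m) \<and> [kfib K (Suc p) = 1] (mod m)"
  have "[kfib K (n + p) = kfib K n] (mod m)" for n
  proof -
    have "[kfib K (n + p) = kfib K (Suc p) * kfib K n] (mod m)"
      using restart by (intro kfib_add_cong) simp
    also have "[kfib K (Suc p) * kfib K n = 1 * kfib K n] (mod m)"
      using restart by (intro cong_mult cong_refl) simp
    finally show ?thesis by simp
  qed
  with restart show "is_kfib_period K m p" by (simp add: is_kfib_period_def)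
qed

lemma is_kfib_period_double:
  assumes "p > 0" and zero: "[kfib K p = 0] (mod m)" and minus_one: "[kfib K (Suc p) = -1] (mod m)"
  shows "is_kfib_period K m (2 * p)"
proof -
  have "[kfib K (p + p) = kfib K (Suc p) * kfib K p] (mod m)"
    using zero by (rule kfib_add_cong)
  also have "[kfib K (Suc p) * kfib K p = -1 * 0] (mod m)"
    using minus_one zero by (rule cong_mult)
  finally have "[kfib K (2 * p) = 0] (mod m)" by (simp add: mult_2)
  moreover have "[kfib K (Suc p + p) = kfib K (Suc p) * kfib K (Suc p)] (mod m)"
    using zero by (rule kfib_add_cong)
  then have "[kfib K (Suc p + p) = -1 * -1] (mod m)"
    using cong_mult[OF minus_one minus_one] by (rule cong_trans)
  then have "[kfib K (Suc (2 * p)) = 1] (mod m)" by (simp add: mult_2)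
  ultimately show ?thesis using \<open>p > 0\<close> by (simp add: is_kfib_period_iff)
qed

lemma kfib_add_mult_period_cong:
  assumes "is_kfib_period K m p"
  shows "[kfib K (n + k * p) = kfib K n] (mod m)"
proof (induction k)
  case (Suc k)
  have "[kfib K (n + k * p + p) = kfib K (n + k * p)] (mod m)"
    using assms by (simp add: is_kfib_period_def)
  then have "[kfib K (n + k * p + p) = kfib K n] (mod m)"
    using Suc.IH by (rule cong_trans)
  then show ?case by (simp add: algebra_simps)
qed simp

lemma is_kfib_period_kfib_pisano:
  assumes "is_kfib_period K m p"
  shows "is_kfib_period K m (kfib_pisano K m)"
  unfolding kfib_pisano_def using assms by (rule LeastI)

lemma kfib_pisano_dvd_period:
  assumes "is_kfib_period K m p"
  shows "kfib_pisano K m dvd p"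
proof (rule ccontr)
  define q where "q = kfib_pisano K m"
  have q: "is_kfib_period K m q"
    unfolding q_def using assms by (rule is_kfib_period_kfib_pisano)
  assume "\<not> kfib_pisano K m dvd p"
  then have "p mod q > 0" by (simp add: q_def mod_greater_zero_iff_not_dvd)
  moreover have "[kfib K (n + p mod q) = kfib K n] (mod m)" for n
  proof -
    have "[kfib K (n + p mod q) = kfib K (n + p mod q + p div q * q)] (mod m)"
      using kfib_add_mult_period_cong[OF q] by (rule cong_sym)
    also have "n + p mod q + p div q * q = n + p" by simp
    also have "[kfib K (n + p) = kfib K n] (mod m)"
      using assms by (simp add: is_kfib_period_def)
    finally show ?thesis .
  qed
  ultimately have "is_kfib_period K m (p mod q)" by (simp add: is_kfib_period_def)
  then have "q \<le> p mod q" unfolding q_def kfib_pisano_def by (rule Least_le)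
  moreover have "p mod q < q" using q by (simp add: is_kfib_period_def)
  ultimately show False by simp
qed

lemma is_kfib_period_iff_kfib_pisano_dvd:
  assumes "is_kfib_period K m p"
  shows "is_kfib_period K m n \<longleftrightarrow> n > 0 \<and> kfib_pisano K m dvd n"
proof
  assume "is_kfib_period K m n"
  then show "n > 0 \<and> kfib_pisano K m dvd n"
    using kfib_pisano_dvd_period by (simp add: is_kfib_period_def)
next
  assume "n > 0 \<and> kfib_pisano K m dvd n"
  then show "is_kfib_period K m n"
    using kfib_add_mult_period_cong[OF is_kfib_period_kfib_pisano[OF assms]]
    by (auto simp: is_kfib_period_def dvd_def mult.commute)
qed

lemma kfib_pisano_eq_prime_power:
  assumes "prime q" and period: "is_kfib_period K m (q ^ Suc k)"
    and not_period: "\<not> is_kfib_period K m (q ^ k)"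
  shows "kfib_pisano K m = q ^ Suc k"
proof -
  have "kfib_pisano K m dvd q ^ Suc k"
    using period by (rule kfib_pisano_dvd_period)
  then obtain i where "i \<le> Suc k" and i: "kfib_pisano K m = q ^ i"
    using divides_primepow_nat[OF \<open>prime q\<close>] by blast
  have "\<not> kfib_pisano K m dvd q ^ k"
    using not_period prime_gt_0_nat[OF \<open>prime q\<close>]
    by (simp add: is_kfib_period_iff_kfib_pisano_dvd[OF period])
  then have "\<not> i \<le> k" using i by (auto simp: le_imp_power_dvd)
  with \<open>i \<le> Suc k\<close> i show ?thesis by (simp add: le_Suc_eq)
qed

lemma kfib_pisano_eq_2_if_dvd:
  assumes "m > 1" and "m dvd K"
  shows "kfib_pisano K m = 2"
proof -
  have "is_kfib_period K m 2"
    using \<open>m dvd K\<close> by (simp add: is_kfib_period_iff numeral_eq_Suc cong_iff_dvd_diff)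
  moreover have "\<not> is_kfib_period K m 1"
    using \<open>m > 1\<close> by (simp add: is_kfib_period_iff cong_0_iff)
  ultimately show ?thesis
    using kfib_pisano_eq_prime_power[of 2 K m 0] by simp
qed

lemma kfib_pisano_eq_8_if_dvd_square_plus_2:
  assumes "m > 2" and "m dvd K\<^sup>2 + 2"
  shows "kfib_pisano K m = 8"
proof -
  have "kfib K 4 = K * (K\<^sup>2 + 2)"
    by (simp add: eval_nat_numeral algebra_simps)
  then have zero: "[kfib K 4 = 0] (mod m)"
    using \<open>m dvd K\<^sup>2 + 2\<close> by (simp add: cong_0_iff)
  have "kfib K 5 - (-1) = (K\<^sup>2 + 1) * (K\<^sup>2 + 2)"
    by (simp add: eval_nat_numeral algebra_simps)
  then have minus_one: "[kfib K (Suc 4) = -1] (mod m)"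
    using \<open>m dvd K\<^sup>2 + 2\<close> by (simp add: cong_iff_dvd_diff)
  have "is_kfib_period K m (2 ^ Suc 2)"
    using is_kfib_period_double[OF _ zero minus_one] by simp
  moreover have "\<not> [-1 = 1] (mod m)"
    using \<open>m > 2\<close> zdvd_not_zless[of 2 m] by (simp add: cong_iff_dvd_diff)
  then have "\<not> is_kfib_period K m (2 ^ 2)"
    using minus_one by (auto simp: is_kfib_period_iff cong_def)
  ultimately show ?thesis
    using kfib_pisano_eq_prime_power[of 2 K m 2] by simp
qed

theorem theorem2p10:
  fixes K :: int
  assumes "K \<ge> 1"
  shows "(3 dvd K \<longrightarrow> kfib_pisano K 3 = 2) \<and> (\<not> 3 dvd K \<longrightarrow> kfib_pisano K 3 = 8)"
proof (intro conjI impI)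
  assume "3 dvd K"
  then show "kfib_pisano K 3 = 2" by (intro kfib_pisano_eq_2_if_dvd) simp_all
next
  assume "\<not> 3 dvd K"
  then have "3 dvd K - 1 \<or> 3 dvd K + 1" by presburger
  then have "3 dvd (K - 1) * (K + 1) + 3" by auto
  also have "(K - 1) * (K + 1) + 3 = K\<^sup>2 + 2" by (simp add: algebra_simps power2_eq_square)
  finally show "kfib_pisano K 3 = 8" by (intro kfib_pisano_eq_8_if_dvd_square_plus_2) simp_all
qed

end
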